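(* Let $\mathcal{F}=\{n_0,\dots,n_m\}\subset\{0,1,2,\dots\}$ with $n_0<\dots<n_m$. Suppose the base distributions $b(n,\boldsymbol{\theta})$ form a canonical $l$-parameter exponential family with $h(n)$, $\mathbf{T}_b(n)=[T_1(n),\dots,T_l(n)]$, $\boldsymbol{\eta}_b=[\eta_1,\dots,\eta_l]\in\mathcal{E}_b$, and $A_b(\boldsymbol{\eta}_b)=\log z_b(\boldsymbol{\eta}_b)$. Then: (1) The type 1 models $p(n,\boldsymbol{\theta},\boldsymbol{\alpha})$ (with $0<\alpha_{n_i}<\infty$) form a canonical $(l+m+1)$-parameter exponential family with the same $h(n)$, $$\mathbf{T}(n)=[\mathbf{T}_b(n),\,T_{l+1}(n)=\mathbf{1}_{n_0}(n),\dots,T_{l+m+1}(n)=\mathbf{1}_{n_m}(n)],$$ $$\boldsymbol{\eta}=[\boldsymbol{\eta}_b,\,\eta_{l+1}=\log\alpha_{n_0},\dots,\eta_{l+m+1}=\log\alpha_{n_m}]\in\mathcal{E}_b\times\mathbb{R}\times\cdots\times\mathbb{R},$$ and $A(\boldsymbol{\eta})=A_b(\boldsymbol{\eta}_b)+\log z(\boldsymbol{\eta})$, where $z(\boldsymbol{\eta})$ is the type 1 normalizing constant $z(\boldsymbol{\theta},\boldsymbol{\alpha})$ expressed in terms of $\boldsymbol{\eta}$. (2) The type 2 models $p(n,\boldsymbol{\theta},\boldsymbol{\varphi})$ (with $0<\varphi_{n_i}<\infty$) form a canonical $(l+m+1)$-parameter exponential family with the same $h(n)$, $$\mathbf{T}(n)=[\mathbf{T}_b(n),\,T_{l+1}(n)=u_{n_0}(n),\dots,T_{l+m+1}(n)=u_{n_m}(n)],$$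 $$\boldsymbol{\eta}=[\boldsymbol{\eta}_b,\,\eta_{l+1}=\log\varphi_{n_0},\dots,\eta_{l+m+1}=\log\varphi_{n_m}]\in\mathcal{E}_b\times\mathbb{R}\times\cdots\times\mathbb{R},$$ and $A(\boldsymbol{\eta})=A_b(\boldsymbol{\eta}_b)+\log z(\boldsymbol{\eta})$, where $z(\boldsymbol{\eta})$ is the type 2 normalizing constant $z(\boldsymbol{\theta},\boldsymbol{\varphi})$ expressed in terms of $\boldsymbol{\eta}$.
   Context: Canonical exponential family: a collection of count distributions $\{q(n,\boldsymbol{\eta}): n\in\{0,1,2,\dots\},\ \boldsymbol{\eta}\in\mathcal{E}\}$ with $\mathcal{E}=\{\boldsymbol{\eta}\in\mathbb{R}^l: A(\boldsymbol{\eta})<\infty\}$ is a canonical $l$-parameter exponential family if $q(n,\boldsymbol{\eta})=h(n)\exp\{\mathbf{T}(n)\boldsymbol{\eta}^T-A(\boldsymbol{\eta})\}$, where $h$ is a real function, $\mathbf{T}(n)$ is a $1\times l$ vector (sufficient statistics), $\boldsymbol{\eta}$ is a $1\times l$ canonical parameter vector, and $A(\boldsymbol{\eta})=\log\sum_{n=0}^\infty h(n)\exp[\mathbf{T}(n)\boldsymbol{\eta}^T]$. (No minimality or linear independence condition is imposed.) The base distribution $b(\cdot,\boldsymbol{\theta})$ is a probability mass function on $\{0,1,2,\dots\}$, stationary for a birth-death process (so $b(n,\boldsymbol{\theta})>0$ for all $n$); here the parameter $\boldsymbol{\theta}$ corresponds to the canonical parameter $\boldsymbol{\eta}_b$, so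 $b(n,\boldsymbol{\theta})=b(n,\boldsymbol{\eta}_b)=h(n)\exp\{\mathbf{T}_b(n)\boldsymbol{\eta}_b^T-A_b(\boldsymbol{\eta}_b)\}$. Type 1 model: $p(n,\boldsymbol{\theta},\boldsymbol{\alpha})=\prod_{i=0}^m\alpha_{n_i}^{\mathbf{1}_{n_i}(n)}\,b(n,\boldsymbol{\theta})/z(\boldsymbol{\theta},\boldsymbol{\alpha})$ with $z(\boldsymbol{\theta},\boldsymbol{\alpha})=1+\sum_{i=0}^m(\alpha_{n_i}-1)b(n_i,\boldsymbol{\theta})$, where $\mathbf{1}_{n_i}(n)=1$ if $n=n_i$ and $0$ otherwise. Type 2 model: $p(n,\boldsymbol{\theta},\boldsymbol{\varphi})=\prod_{i=0}^m\varphi_{n_i}^{u_{n_i}(n)}\,b(n,\boldsymbol{\theta})/z(\boldsymbol{\theta},\boldsymbol{\varphi})$ with $z(\boldsymbol{\theta},\boldsymbol{\varphi})=1+\sum_{i=0}^m\bigl(\prod_{j=i}^m\varphi_{n_j}-1\bigr)\sum_{k=n_{i-1}+1}^{n_i}b(k,\boldsymbol{\theta})$, $n_{-1}=-1$, where $u_{n_i}(n)=1$ if $n\le n_i$ and $0$ otherwise. *)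

theory Defs
  imports Complex_Main "HOL-Library.Extended_Real" "HOL-Library.Indicator_Function"
    "Jordan_Normal_Form.Matrix"
begin

text \<open>Vectors in $R^l$ are elements of \<^term>\<open>carrier_vec l\<close>, with 0-based components.\<close>

definition count_distribution :: "(nat \<Rightarrow> real) \<Rightarrow> bool" where
  "count_distribution q \<longleftrightarrow> (\<forall>n. 0 \<le> q n) \<and> q sums 1"

text \<open>
  $A(\eta) = \log \sum_n h(n) \exp(T(n) \cdot \eta)$. The library has no logarithm on the extended
  reals, hence the case distinction. Only the case of nonnegative \<open>h\<close> matters: if some member
  of a family with carrier \<open>h\<close> is a distribution, then \<open>h\<close> is nonnegative. So the series is
  either summable or has the sum $\infty$.
\<close>

definition log_partition :: "(nat \<Rightarrow> real) \<Rightarrow> (nat \<Rightarrow> real vec) \<Rightarrow> real vec \<Rightarrow> ereal" where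
  "log_partition h T \<eta> =
     (if summable (\<lambda>n. h n * exp (T n \<bullet> \<eta>))
      then ereal (ln (\<Sum>n. h n * exp (T n \<bullet> \<eta>))) else \<infinity>)"

definition natural_space :: "nat \<Rightarrow> (nat \<Rightarrow> real) \<Rightarrow> (nat \<Rightarrow> real vec) \<Rightarrow> real vec set" where
  "natural_space l h T = {\<eta> \<in> carrier_vec l. log_partition h T \<eta> < \<infinity>}"

text \<open>
  A family \<open>q\<close> that is given in a parametrization of its own, by \<open>\<theta> \<in> \<Theta>\<close>. The map \<open>eta\<close> sends
  \<open>\<theta>\<close> to the corresponding canonical parameter; the canonical parameters attained are exactly
  the points of the natural parameter space. A family indexed by \<open>\<eta>\<close> itself is the case
  \<open>eta = (\<lambda>\<eta>. \<eta>)\<close>.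
\<close>

definition canonical_exp_family ::
  "nat \<Rightarrow> (nat \<Rightarrow> real) \<Rightarrow> (nat \<Rightarrow> real vec) \<Rightarrow> 'p set \<Rightarrow> ('p \<Rightarrow> real vec) \<Rightarrow> ('p \<Rightarrow> nat \<Rightarrow> real) \<Rightarrow> bool"
  where
  "canonical_exp_family l h T \<Theta> eta q \<longleftrightarrow>
     (\<forall>n. T n \<in> carrier_vec l) \<and>
     eta ` \<Theta> = natural_space l h T \<and>
     (\<forall>\<theta>\<in>\<Theta>. count_distribution (q \<theta>) \<and>
        (\<forall>n. q \<theta> n = h n * exp (T n \<bullet> eta \<theta> - real_of_ereal (log_partition h T (eta \<theta>)))))"

text \<open>
  The sites $n_0 < \dots < n_m$ are \<open>ns 0, \<dots>, ns m\<close>. The multipliers $\alpha_{n_i}$ and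
  $\varphi_{n_i}$ are the components \<open>\<alpha> $ i\<close> and \<open>\<phi> $ i\<close> of vectors of dimension \<open>m + 1\<close>.
  The base distribution is \<open>b\<close>.
\<close>

definition positive_vecs :: "nat \<Rightarrow> real vec set" where
  "positive_vecs k = {v \<in> carrier_vec k. \<forall>i<k. 0 < v $ i}"

definition type1_norm :: "nat \<Rightarrow> (nat \<Rightarrow> nat) \<Rightarrow> (nat \<Rightarrow> real) \<Rightarrow> real vec \<Rightarrow> real" where
  "type1_norm m ns b \<alpha> = 1 + (\<Sum>i=0..m. (\<alpha> $ i - 1) * b (ns i))"

definition type1_model :: "nat \<Rightarrow> (nat \<Rightarrow> nat) \<Rightarrow> (nat \<Rightarrow> real) \<Rightarrow> real vec \<Rightarrow> nat \<Rightarrow> real" where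
  "type1_model m ns b \<alpha> n =
     (\<Prod>i=0..m. (\<alpha> $ i) ^ indicator {ns i} n) * b n / type1_norm m ns b \<alpha>"

definition type1_stat :: "nat \<Rightarrow> (nat \<Rightarrow> nat) \<Rightarrow> (nat \<Rightarrow> real vec) \<Rightarrow> nat \<Rightarrow> real vec" where
  "type1_stat m ns T n = T n @\<^sub>v vec (m + 1) (\<lambda>i. indicator {ns i} n)"

text \<open>The conditional encodes $n_{i-1} + 1$ with the convention $n_{-1} = -1$.\<close>

definition type2_norm :: "nat \<Rightarrow> (nat \<Rightarrow> nat) \<Rightarrow> (nat \<Rightarrow> real) \<Rightarrow> real vec \<Rightarrow> real" where
  "type2_norm m ns b \<phi> =
     1 + (\<Sum>i=0..m. ((\<Prod>j=i..m. \<phi> $ j) - 1) *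
            (\<Sum>k = (if i = 0 then 0 else ns (i - 1) + 1)..ns i. b k))"

definition type2_model :: "nat \<Rightarrow> (nat \<Rightarrow> nat) \<Rightarrow> (nat \<Rightarrow> real) \<Rightarrow> real vec \<Rightarrow> nat \<Rightarrow> real" where
  "type2_model m ns b \<phi> n =
     (\<Prod>i=0..m. (\<phi> $ i) ^ indicator {..ns i} n) * b n / type2_norm m ns b \<phi>"

definition type2_stat :: "nat \<Rightarrow> (nat \<Rightarrow> nat) \<Rightarrow> (nat \<Rightarrow> real vec) \<Rightarrow> nat \<Rightarrow> real vec" where
  "type2_stat m ns T n = T n @\<^sub>v vec (m + 1) (\<lambda>i. indicator {..ns i} n)"

end

theory Submission
  imports Defs
begin

text \<open>
  Multiplying a member of an exponential family by $\prod_i v_i^{1_{S_i}(n)}$ appends the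
  indicators of the sets $S_i$ to the sufficient statistic and the numbers $\log v_i$ to the
  canonical parameter. As the $S_i$ are finite, only finitely many terms of the partition series
  change, so $v$ is unrestricted. Both models are of this kind: $S_i = \{n_i\}$ for type 1,
  $S_i = \{0, \dots, n_i\}$ for type 2.
\<close>

section \<open>Weights and statistics of the tilt\<close>

definition tilt_weight :: "nat \<Rightarrow> (nat \<Rightarrow> nat set) \<Rightarrow> real vec \<Rightarrow> nat \<Rightarrow> real" where
  "tilt_weight m S v n = (\<Prod>i=0..m. v $ i ^ indicator (S i) n)"

definition tilt_stat :: "nat \<Rightarrow> (nat \<Rightarrow> nat set) \<Rightarrow> (nat \<Rightarrow> real vec) \<Rightarrow> nat \<Rightarrow> real vec" where
  "tilt_stat m S T n = T n @\<^sub>v vec (m + 1) (\<lambda>i. indicator (S i) n)"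

lemma tilt_weight_pos: "v \<in> positive_vecs (m + 1) \<Longrightarrow> 0 < tilt_weight m S v n"
  unfolding tilt_weight_def positive_vecs_def by (intro prod_pos) auto

lemma eventually_tilt_weight_eq_1:
  assumes "\<And>i. i \<le> m \<Longrightarrow> finite (S i)"
  shows "eventually (\<lambda>n. tilt_weight m S v n = 1) sequentially"
proof -
  have "finite (\<Union>i\<in>{0..m}. S i)"
    using assms by auto
  then obtain K where K: "\<And>n. n \<in> (\<Union>i\<in>{0..m}. S i) \<Longrightarrow> n < K"
    by (auto simp: finite_nat_set_iff_bounded)
  have "tilt_weight m S v n = 1" if "n \<ge> K" for n
    unfolding tilt_weight_def using K[of n] that
    by (intro prod.neutral) (auto simp: indicator_def)
  then show ?thesis
    unfolding eventually_sequentially by blast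
qed

lemma exp_tilt_stat:
  assumes "T n \<in> carrier_vec l" "\<eta> \<in> carrier_vec l" "v \<in> positive_vecs (m + 1)"
  shows "exp (tilt_stat m S T n \<bullet> (\<eta> @\<^sub>v map_vec ln v)) = exp (T n \<bullet> \<eta>) * tilt_weight m S v n"
proof -
  have v: "v \<in> carrier_vec (m + 1)" "\<And>i. i \<le> m \<Longrightarrow> 0 < v $ i"
    using assms(3) by (auto simp: positive_vecs_def)
  have "tilt_stat m S T n \<bullet> (\<eta> @\<^sub>v map_vec ln v)
      = T n \<bullet> \<eta> + vec (m + 1) (\<lambda>i. indicator (S i) n) \<bullet> map_vec ln v"
    unfolding tilt_stat_def using assms v by (intro scalar_prod_append) auto
  also have "vec (m + 1) (\<lambda>i. indicator (S i) n) \<bullet> map_vec ln v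
      = (\<Sum>i=0..m. indicator (S i) n * ln (v $ i))"
    using v unfolding scalar_prod_def
    by (intro sum.cong) auto
  finally have "exp (tilt_stat m S T n \<bullet> (\<eta> @\<^sub>v map_vec ln v))
      = exp (T n \<bullet> \<eta>) * (\<Prod>i=0..m. exp (indicator (S i) n * ln (v $ i)))"
    by (simp add: exp_add exp_sum)
  also have "(\<Prod>i=0..m. exp (indicator (S i) n * ln (v $ i))) = tilt_weight m S v n"
    unfolding tilt_weight_def
    by (intro prod.cong) (auto simp: indicator_def v(2))
  finally show ?thesis .
qed

text \<open>The appended canonical parameters thus range over a full Euclidean space. This lets an
  arbitrary real block be treated as a vector of log multipliers, and it identifies the attained
  canonical parameters with the natural space.\<close>

lemma map_vec_ln_positive_vecs: "map_vec ln ` positive_vecs k = carrier_vec k"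
proof (intro equalityI subsetI)
  fix \<zeta> :: "real vec" assume "\<zeta> \<in> carrier_vec k"
  then have "\<zeta> = map_vec ln (map_vec exp \<zeta>)" "map_vec exp \<zeta> \<in> positive_vecs k"
    by (auto simp: positive_vecs_def)
  then show "\<zeta> \<in> map_vec ln ` positive_vecs k"
    by blast
qed (auto simp: positive_vecs_def)

section \<open>Natural parameter space and members of the tilted family\<close>

lemma natural_space_iff:
  "\<eta> \<in> natural_space l h T \<longleftrightarrow> \<eta> \<in> carrier_vec l \<and> summable (\<lambda>n. h n * exp (T n \<bullet> \<eta>))"
  by (simp add: natural_space_def log_partition_def)

lemma log_partition_sums:
  "(\<lambda>n. h n * exp (T n \<bullet> \<eta>)) sums s \<Longrightarrow> log_partition h T \<eta> = ereal (ln s)"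
  by (auto simp: log_partition_def sums_iff)

text \<open>Writing \<zeta> as the logarithm of a positive vector turns the tilted series into the
  base series times a weight that is eventually 1. Summability therefore depends on \<eta> alone,
  and \<zeta> is free.\<close>

lemma natural_space_tilt:
  assumes fin: "\<And>i. i \<le> m \<Longrightarrow> finite (S i)" and T: "\<And>n. T n \<in> carrier_vec l"
  shows "natural_space (l + m + 1) h (tilt_stat m S T)
    = {\<eta> @\<^sub>v \<zeta> | \<eta> \<zeta>. \<eta> \<in> natural_space l h T \<and> \<zeta> \<in> carrier_vec (m + 1)}"
proof -
  have summ: "summable (\<lambda>n. h n * exp (tilt_stat m S T n \<bullet> (\<eta> @\<^sub>v \<zeta>)))
      \<longleftrightarrow> summable (\<lambda>n. h n * exp (T n \<bullet> \<eta>))"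
    if \<eta>: "\<eta> \<in> carrier_vec l" and \<zeta>: "\<zeta> \<in> carrier_vec (m + 1)" for \<eta> \<zeta>
  proof -
    obtain v where v: "v \<in> positive_vecs (m + 1)" "\<zeta> = map_vec ln v"
      using \<zeta> map_vec_ln_positive_vecs[of "m + 1"] by blast
    show ?thesis
      unfolding v(2) exp_tilt_stat[where T = T, OF T \<eta> v(1)]
      by (intro summable_cong eventually_mono[OF eventually_tilt_weight_eq_1[of m S v]])
        (use fin in auto)
  qed
  \<comment> \<open>\<open>l + m + 1\<close> parses as \<open>(l + m) + 1\<close>, whereas appending
    yields dimension \<open>l + (m + 1)\<close>; hence \<open>add.assoc\<close> here and
    below.\<close>
  have append: "\<eta> @\<^sub>v \<zeta> \<in> carrier_vec (l + m + 1)"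
    if "\<eta> \<in> carrier_vec l" "\<zeta> \<in> carrier_vec (m + 1)" for \<eta> \<zeta> :: "real vec"
    using append_carrier_vec[OF that] by (simp add: add.assoc)
  show ?thesis
  proof (intro equalityI subsetI)
    fix x assume x: "x \<in> natural_space (l + m + 1) h (tilt_stat m S T)"
    then have "x \<in> carrier_vec (l + (m + 1))"
      by (simp add: natural_space_iff add.assoc)
    then have "x = vec_first x l @\<^sub>v vec_last x (m + 1)"
      by simp
    moreover from this have "vec_first x l \<in> natural_space l h T"
      using x summ[of "vec_first x l" "vec_last x (m + 1)"] by (simp add: natural_space_iff)
    ultimately show "x \<in> {\<eta> @\<^sub>v \<zeta> | \<eta> \<zeta>. \<eta> \<in> natural_space l h T \<and> \<zeta> \<in> carrier_vec (m + 1)}"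
      using vec_last_carrier by blast
  qed (auto simp: natural_space_iff summ intro: append[simplified])
qed

text \<open>The normalizer \<open>z\<close> is kept abstract, known only as the sum of the tilted
  base distribution, so that one argument serves both models. If s is the base partition sum, the
  tilted partition series sums to s times \<open>z \<theta> v\<close>, and its logarithm splits into
  the two summands of the claim.\<close>

theorem canonical_exp_family_tilt:
  assumes fam: "canonical_exp_family l h T \<Theta> eta b"
    and pos: "\<And>\<theta> n. \<theta> \<in> \<Theta> \<Longrightarrow> 0 < b \<theta> n"
    and fin: "\<And>i. i \<le> m \<Longrightarrow> finite (S i)"
    and norm: "\<And>\<theta> v. \<theta> \<in> \<Theta> \<Longrightarrow> v \<in> positive_vecs (m + 1) \<Longrightarrow>
      (\<lambda>n. tilt_weight m S v n * b \<theta> n) sums z \<theta> v"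
  shows "canonical_exp_family (l + m + 1) h (tilt_stat m S T) (\<Theta> \<times> positive_vecs (m + 1))
      (\<lambda>(\<theta>, v). eta \<theta> @\<^sub>v map_vec ln v) (\<lambda>(\<theta>, v) n. tilt_weight m S v n * b \<theta> n / z \<theta> v)"
    and "\<forall>\<theta>\<in>\<Theta>. \<forall>v\<in>positive_vecs (m + 1).
      log_partition h (tilt_stat m S T) (eta \<theta> @\<^sub>v map_vec ln v)
        = log_partition h T (eta \<theta>) + ereal (ln (z \<theta> v))"
proof -
  have T: "T n \<in> carrier_vec l" for n
    using fam by (simp add: canonical_exp_family_def)
  have eta: "eta ` \<Theta> = natural_space l h T"
    using fam by (simp add: canonical_exp_family_def)
  have member: "count_distribution (\<lambda>n. tilt_weight m S v n * b \<theta> n / z \<theta> v)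
     \<and> log_partition h (tilt_stat m S T) (eta \<theta> @\<^sub>v map_vec ln v)
         = log_partition h T (eta \<theta>) + ereal (ln (z \<theta> v))
     \<and> (\<forall>n. tilt_weight m S v n * b \<theta> n / z \<theta> v
         = h n * exp (tilt_stat m S T n \<bullet> (eta \<theta> @\<^sub>v map_vec ln v)
             - real_of_ereal (log_partition h (tilt_stat m S T) (eta \<theta> @\<^sub>v map_vec ln v))))"
    if \<theta>: "\<theta> \<in> \<Theta>" and v: "v \<in> positive_vecs (m + 1)" for \<theta> v
  proof -
    define s where "s = (\<Sum>n. h n * exp (T n \<bullet> eta \<theta>))"
    have mem: "eta \<theta> \<in> carrier_vec l" and summ: "summable (\<lambda>n. h n * exp (T n \<bullet> eta \<theta>))"
      using eta \<theta> natural_space_iff by blast+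
    have L: "log_partition h T (eta \<theta>) = ereal (ln s)"
      using summ by (simp add: log_partition_def s_def)
    have b: "b \<theta> n = h n * exp (T n \<bullet> eta \<theta> - ln s)" for n
      using fam \<theta> L by (simp add: canonical_exp_family_def)
    \<comment> \<open>Positivity of \<open>b\<close> passes to the terms of the base series. So s is
      positive, and \<open>ln s\<close> is a true logarithm: \<open>exp (ln s)\<close> gives back s,
      and \<open>ln_mult\<close> applies.\<close>
    have "0 < h n * exp (T n \<bullet> eta \<theta>)" for n
      using pos[OF \<theta>, of n] unfolding b by (simp add: zero_less_mult_iff)
    then have s: "0 < s"
      unfolding s_def by (intro suminf_pos summ)
    have z: "0 < z \<theta> v"
      using suminf_pos[OF sums_summable[OF norm[OF \<theta> v]]] norm[OF \<theta> v]
        tilt_weight_pos[OF v] pos[OF \<theta>] by (simp add: sums_iff)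
    \<comment> \<open>\<open>b \<theta> n\<close> already contains the factor 1/s; multiplying by s
      undoes the base normalization.\<close>
    have summand: "h n * exp (tilt_stat m S T n \<bullet> (eta \<theta> @\<^sub>v map_vec ln v))
        = s * (tilt_weight m S v n * b \<theta> n)" for n
      unfolding exp_tilt_stat[where T = T, OF T mem v] b using s by (simp add: exp_diff)
    have L': "log_partition h (tilt_stat m S T) (eta \<theta> @\<^sub>v map_vec ln v) = ereal (ln (s * z \<theta> v))"
      by (rule log_partition_sums) (unfold summand, intro sums_mult norm \<theta> v)
    have "(\<lambda>n. tilt_weight m S v n * b \<theta> n / z \<theta> v) sums 1"
      using sums_divide[OF norm[OF \<theta> v], of "z \<theta> v"] z by simp
    moreover have "0 \<le> tilt_weight m S v n * b \<theta> n / z \<theta> v" for n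
      using tilt_weight_pos[OF v, of S n] pos[OF \<theta>, of n] z by simp
    moreover have "tilt_weight m S v n * b \<theta> n / z \<theta> v
        = h n * exp (tilt_stat m S T n \<bullet> (eta \<theta> @\<^sub>v map_vec ln v) - ln (s * z \<theta> v))" for n
    proof -
      have "h n * exp (tilt_stat m S T n \<bullet> (eta \<theta> @\<^sub>v map_vec ln v) - ln (s * z \<theta> v))
          = s * (tilt_weight m S v n * b \<theta> n) / (s * z \<theta> v)"
        using s z by (simp add: exp_diff flip: summand)
      then show ?thesis
        using s by simp
    qed
    ultimately show ?thesis
      using s z by (simp add: count_distribution_def L L' ln_mult)
  qed
  have "(\<lambda>(\<theta>, v). eta \<theta> @\<^sub>v map_vec ln v) ` (\<Theta> \<times> positive_vecs (m + 1))
      = {\<eta> @\<^sub>v \<zeta> | \<eta> \<zeta>. \<eta> \<in> eta ` \<Theta> \<and> \<zeta> \<in> map_vec ln ` positive_vecs (m + 1)}"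
    by auto
  also have "\<dots> = natural_space (l + m + 1) h (tilt_stat m S T)"
    unfolding eta map_vec_ln_positive_vecs using natural_space_tilt[OF fin T] by simp
  finally have image: "(\<lambda>(\<theta>, v). eta \<theta> @\<^sub>v map_vec ln v) ` (\<Theta> \<times> positive_vecs (m + 1))
      = natural_space (l + m + 1) h (tilt_stat m S T)" .
  have "tilt_stat m S T n \<in> carrier_vec (l + m + 1)" for n
    using append_carrier_vec[OF T[of n] vec_carrier, of "m + 1" "\<lambda>i. indicator (S i) n"]
    by (simp add: tilt_stat_def add.assoc)
  then show "canonical_exp_family (l + m + 1) h (tilt_stat m S T) (\<Theta> \<times> positive_vecs (m + 1))
      (\<lambda>(\<theta>, v). eta \<theta> @\<^sub>v map_vec ln v) (\<lambda>(\<theta>, v) n. tilt_weight m S v n * b \<theta> n / z \<theta> v)"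
    unfolding canonical_exp_family_def split_paired_Ball_Sigma prod.case
    using image member by blast
  show "\<forall>\<theta>\<in>\<Theta>. \<forall>v\<in>positive_vecs (m + 1).
      log_partition h (tilt_stat m S T) (eta \<theta> @\<^sub>v map_vec ln v)
        = log_partition h T (eta \<theta>) + ereal (ln (z \<theta> v))"
    using member by blast
qed

section \<open>Evaluating the normalizing constants\<close>

lemma sums_step_weight:
  fixes b w :: "nat \<Rightarrow> real"
  assumes b: "b sums s" and fin: "finite I" "\<And>i. i \<in> I \<Longrightarrow> finite (B i)"
    and disj: "disjoint_family_on B I"
    and inside: "\<And>i n. i \<in> I \<Longrightarrow> n \<in> B i \<Longrightarrow> w n = c i"
    and outside: "\<And>n. n \<notin> (\<Union>i\<in>I. B i) \<Longrightarrow> w n = 1"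
  shows "(\<lambda>n. w n * b n) sums (s + (\<Sum>i\<in>I. (c i - 1) * (\<Sum>k\<in>B i. b k)))"
proof -
  \<comment> \<open>Split \<open>w n * b n\<close> as \<open>b n + (w n - 1) * b n\<close>. The
    second term vanishes off the finite union of the blocks and has a constant coefficient on each
    block, which produces the common shape of both normalizing constants.\<close>
  have "(\<lambda>n. (w n - 1) * b n) sums (\<Sum>n\<in>(\<Union>i\<in>I. B i). (w n - 1) * b n)"
    using fin outside by (intro sums_finite) auto
  also have "(\<Sum>n\<in>(\<Union>i\<in>I. B i). (w n - 1) * b n) = (\<Sum>i\<in>I. \<Sum>n\<in>B i. (w n - 1) * b n)"
    using fin disj by (intro sum.UNION_disjoint) (auto simp: disjoint_family_on_def)
  also have "\<dots> = (\<Sum>i\<in>I. (c i - 1) * (\<Sum>k\<in>B i. b k))"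
    unfolding sum_distrib_left using inside by (intro sum.cong) auto
  finally have "(\<lambda>n. (w n - 1) * b n) sums (\<Sum>i\<in>I. (c i - 1) * (\<Sum>k\<in>B i. b k))" .
  from sums_add[OF b this] show ?thesis
    by (simp add: algebra_simps)
qed

lemma type1_norm_sums:
  assumes ns: "strict_mono_on {0..m} ns" and b: "b sums 1"
  shows "(\<lambda>n. tilt_weight m (\<lambda>i. {ns i}) v n * b n) sums type1_norm m ns b v"
proof -
  have inj: "ns j = ns i \<longleftrightarrow> j = i" if "i \<le> m" "j \<le> m" for i j
    using strict_mono_on_imp_inj_on[OF ns] that by (auto dest: inj_onD)
  have "(\<lambda>n. tilt_weight m (\<lambda>i. {ns i}) v n * b n)
      sums (1 + (\<Sum>i\<in>{0..m}. (v $ i - 1) * (\<Sum>k\<in>{ns i}. b k)))"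
  proof (rule sums_step_weight[OF b])
    fix i n assume i: "i \<in> {0..m}" and n: "n \<in> {ns i}"
    \<comment> \<open>The sites are distinct, so at \<open>ns i\<close> only the factor with index
      \<open>i\<close> survives.\<close>
    have "tilt_weight m (\<lambda>i. {ns i}) v n = (\<Prod>j=0..m. if j = i then v $ j else 1)"
      unfolding tilt_weight_def using i n inj
      by (intro prod.cong) (auto simp: indicator_def)
    then show "tilt_weight m (\<lambda>i. {ns i}) v n = v $ i"
      using i by simp
  next
    fix n assume "n \<notin> (\<Union>i\<in>{0..m}. {ns i})"
    then show "tilt_weight m (\<lambda>i. {ns i}) v n = 1"
      unfolding tilt_weight_def by (intro prod.neutral) (auto simp: indicator_def)
  qed (auto simp: disjoint_family_on_def inj)
  then show ?thesis
    by (simp add: type1_norm_def)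
qed

lemma type2_norm_sums:
  assumes ns: "strict_mono_on {0..m} ns" and b: "b sums 1"
  shows "(\<lambda>n. tilt_weight m (\<lambda>i. {..ns i}) v n * b n) sums type2_norm m ns b v"
proof -
  define B where "B i = {(if i = 0 then 0 else ns (i - 1) + 1)..ns i}" for i
  have mono: "ns i \<le> ns j" if "i \<le> j" "j \<le> m" for i j
    using strict_mono_on_leD[OF ns] that by auto
  \<comment> \<open>This equivalence yields both the value of the weight on a block and the
    disjointness of the blocks.\<close>
  have below: "n \<le> ns j \<longleftrightarrow> i \<le> j" if "n \<in> B i" "i \<le> m" "j \<le> m" for n i j
  proof
    assume "i \<le> j"
    then show "n \<le> ns j"
      using that mono[of i j] by (auto simp: B_def)
  next
    \<comment> \<open>If j < i, then i is nonzero and j \<le> i - 1, so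
      \<open>n \<le> ns j \<le> ns (i - 1) < n\<close>, a contradiction.\<close>
    assume "n \<le> ns j"
    then show "i \<le> j"
      using that mono[of j "i - 1"] by (cases "i \<le> j") (force simp: B_def split: if_splits)+
  qed
  have "(\<lambda>n. tilt_weight m (\<lambda>i. {..ns i}) v n * b n)
      sums (1 + (\<Sum>i\<in>{0..m}. ((\<Prod>j=i..m. v $ j) - 1) * (\<Sum>k\<in>B i. b k)))"
  proof (rule sums_step_weight[OF b])
    fix i n assume i: "i \<in> {0..m}" and n: "n \<in> B i"
    have "tilt_weight m (\<lambda>i. {..ns i}) v n = (\<Prod>j=0..m. if j \<in> {i..m} then v $ j else 1)"
      unfolding tilt_weight_def using below[OF n] i
      by (intro prod.cong) (auto simp: indicator_def)
    also have "\<dots> = (\<Prod>j\<in>{0..m} \<inter> {i..m}. v $ j)"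
      by (simp only: prod.inter_restrict finite_atLeastAtMost)
    also have "{0..m} \<inter> {i..m} = {i..m}"
      by auto
    finally show "tilt_weight m (\<lambda>i. {..ns i}) v n = (\<Prod>j=i..m. v $ j)" .
  next
    fix n assume out: "n \<notin> (\<Union>i\<in>{0..m}. B i)"
    \<comment> \<open>A point outside all blocks lies beyond every site: block 0 starts at 0, and
      each later block starts right after the preceding site, so the induction leaves no gap. All
      indicators then vanish.\<close>
    have "ns i < n" if "i \<le> m" for i
      using that
    proof (induction i)
      case 0
      then show ?case
        using out by (force simp: B_def)
    next
      case (Suc i)
      then have "n \<notin> B (Suc i)"
        using out by auto
      then show ?case
        using Suc by (auto simp: B_def)
    qed
    then show "tilt_weight m (\<lambda>i. {..ns i}) v n = 1"
      unfolding tilt_weight_def by (intro prod.neutral) (force simp: indicator_def)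
  next
    \<comment> \<open>A common point of \<open>B i\<close> and \<open>B j\<close> is at most
      \<open>ns i\<close> and at most \<open>ns j\<close>, so \<open>below\<close> gives i \<le> j
      and j \<le> i.\<close>
    show "disjoint_family_on B {0..m}"
      unfolding disjoint_family_on_def
      using below by (metis IntE atLeastAtMost_iff equals0I le_antisym order_refl)
  qed (auto simp: B_def)
  then show ?thesis
    by (simp add: type2_norm_def B_def)
qed

theorem proposition5:
  fixes l m :: nat and ns :: "nat \<Rightarrow> nat"
    and h :: "nat \<Rightarrow> real" and T\<^sub>b :: "nat \<Rightarrow> real vec"
    and \<Theta> :: "'p set" and \<eta>\<^sub>b :: "'p \<Rightarrow> real vec" and b :: "'p \<Rightarrow> nat \<Rightarrow> real"
  assumes "strict_mono_on {0..m} ns"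
    and "\<And>\<theta> n. \<theta> \<in> \<Theta> \<Longrightarrow> 0 < b \<theta> n"
    and "canonical_exp_family l h T\<^sub>b \<Theta> \<eta>\<^sub>b b"
  shows
    "(canonical_exp_family (l + m + 1) h (type1_stat m ns T\<^sub>b)
        (\<Theta> \<times> positive_vecs (m + 1))
        (\<lambda>(\<theta>, \<alpha>). \<eta>\<^sub>b \<theta> @\<^sub>v map_vec ln \<alpha>)
        (\<lambda>(\<theta>, \<alpha>). type1_model m ns (b \<theta>) \<alpha>)
      \<and> natural_space (l + m + 1) h (type1_stat m ns T\<^sub>b)
          = {\<eta> @\<^sub>v \<zeta> | \<eta> \<zeta>. \<eta> \<in> natural_space l h T\<^sub>b \<and> \<zeta> \<in> carrier_vec (m + 1)}
      \<and> (\<forall>\<theta>\<in>\<Theta>. \<forall>\<alpha>\<in>positive_vecs (m + 1).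
           log_partition h (type1_stat m ns T\<^sub>b) (\<eta>\<^sub>b \<theta> @\<^sub>v map_vec ln \<alpha>)
             = log_partition h T\<^sub>b (\<eta>\<^sub>b \<theta>) + ereal (ln (type1_norm m ns (b \<theta>) \<alpha>))))
   \<and> (canonical_exp_family (l + m + 1) h (type2_stat m ns T\<^sub>b)
        (\<Theta> \<times> positive_vecs (m + 1))
        (\<lambda>(\<theta>, \<phi>). \<eta>\<^sub>b \<theta> @\<^sub>v map_vec ln \<phi>)
        (\<lambda>(\<theta>, \<phi>). type2_model m ns (b \<theta>) \<phi>)
      \<and> natural_space (l + m + 1) h (type2_stat m ns T\<^sub>b)
          = {\<eta> @\<^sub>v \<zeta> | \<eta> \<zeta>. \<eta> \<in> natural_space l h T\<^sub>b \<and> \<zeta> \<in> carrier_vec (m + 1)}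
      \<and> (\<forall>\<theta>\<in>\<Theta>. \<forall>\<phi>\<in>positive_vecs (m + 1).
           log_partition h (type2_stat m ns T\<^sub>b) (\<eta>\<^sub>b \<theta> @\<^sub>v map_vec ln \<phi>)
             = log_partition h T\<^sub>b (\<eta>\<^sub>b \<theta>) + ereal (ln (type2_norm m ns (b \<theta>) \<phi>))))"
proof -
  have T: "T\<^sub>b n \<in> carrier_vec l" for n
    using assms(3) by (simp add: canonical_exp_family_def)
  have b: "b \<theta> sums 1" if "\<theta> \<in> \<Theta>" for \<theta>
    using assms(3) that by (simp add: canonical_exp_family_def count_distribution_def)
  have stat: "type1_stat m ns T\<^sub>b = tilt_stat m (\<lambda>i. {ns i}) T\<^sub>b"
    "type2_stat m ns T\<^sub>b = tilt_stat m (\<lambda>i. {..ns i}) T\<^sub>b"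
    by (simp_all add: fun_eq_iff type1_stat_def type2_stat_def tilt_stat_def)
  have model:
    "(\<lambda>(\<theta>, v). type1_model m ns (b \<theta>) v)
      = (\<lambda>(\<theta>, v) n. tilt_weight m (\<lambda>i. {ns i}) v n * b \<theta> n / type1_norm m ns (b \<theta>) v)"
    "(\<lambda>(\<theta>, v). type2_model m ns (b \<theta>) v)
      = (\<lambda>(\<theta>, v) n. tilt_weight m (\<lambda>i. {..ns i}) v n * b \<theta> n / type2_norm m ns (b \<theta>) v)"
    by (simp_all add: fun_eq_iff type1_model_def type2_model_def tilt_weight_def)
  \<comment> \<open>The placeholder \<open>_\<close> stands for the finiteness of the sets, which
    the final \<open>simp_all\<close> discharges; likewise for \<open>type2\<close>.\<close>
  note type1 = canonical_exp_family_tilt[where S = "\<lambda>i. {ns i}" and m = m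
      and z = "\<lambda>\<theta>. type1_norm m ns (b \<theta>)",
      OF assms(3) assms(2) _ type1_norm_sums[OF assms(1) b]]
  note type2 = canonical_exp_family_tilt[where S = "\<lambda>i. {..ns i}" and m = m
      and z = "\<lambda>\<theta>. type2_norm m ns (b \<theta>)",
      OF assms(3) assms(2) _ type2_norm_sums[OF assms(1) b]]
  show ?thesis
    unfolding stat model
    by (intro conjI type1 type2 natural_space_tilt T) simp_all
qed

end
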